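(* Let $N>3$ and $h_3^{(N)}=\sum_{1\le i<j<l\le N}\sigma_z^{i}\sigma_z^{j}\sigma_z^{l}$ on $(\mathbb{C}^2)^{\otimes N}$. The maximum of $4\left(\langle\psi|(h_3^{(N)})^2|\psi\rangle-\langle\psi|h_3^{(N)}|\psi\rangle^2\right)$ over all symmetric product states $|\psi\rangle=|\varphi\rangle^{\otimes N}$, with $|\varphi\rangle\in\mathbb{C}^2$ a unit vector, equals $$\frac{2(N-2)N\left[(N-3)\left((N-3)N+4\right)x+(N-1)\left(N(N-3)^2+4\right)(N-2)^3\right]}{3\left(3(N-5)N+20\right)^2},$$ where $x=\sqrt{(N-3)(N-2)^3(N-1)^2\left((N-3)N+4\right)}$.
   Context: $\sigma_z^{i}$ denotes $\sigma_z=\mathrm{diag}(1,-1)$ acting on the $i$-th qubit and as the identity on the others. The maximized quantity is the quantum Fisher information for estimating $J$ in the encoding Hamiltonian $Jh_3^{(N)}$ with pure probe $|\psi\rangle$. *)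

theory Defs
  imports Complex_Main "Jordan_Normal_Form.Matrix"
begin

text \<open>
  The space of \<open>N\<close> qubits is \<open>carrier_vec (2 ^ N)\<close> over the complex numbers. The tensor product
  is the Kronecker product, and tensor factors are numbered from \<open>1\<close> to \<open>N\<close>.
\<close>

definition kron_vec :: "complex vec \<Rightarrow> complex vec \<Rightarrow> complex vec" where
  "kron_vec u v = vec (dim_vec u * dim_vec v)
     (\<lambda>i. u $ (i div dim_vec v) * v $ (i mod dim_vec v))"

definition kron_mat :: "complex mat \<Rightarrow> complex mat \<Rightarrow> complex mat" where
  "kron_mat A B = mat (dim_row A * dim_row B) (dim_col A * dim_col B)
     (\<lambda>(i, j). A $$ (i div dim_row B, j div dim_col B) * B $$ (i mod dim_row B, j mod dim_col B))"

definition tensor_vecs :: "complex vec list \<Rightarrow> complex vec" where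
  "tensor_vecs vs = foldr kron_vec vs (unit_vec 1 0)"

definition tensor_mats :: "complex mat list \<Rightarrow> complex mat" where
  "tensor_mats As = foldr kron_mat As (1\<^sub>m 1)"

definition tensor_power_vec :: "complex vec \<Rightarrow> nat \<Rightarrow> complex vec" where
  "tensor_power_vec v N = tensor_vecs (replicate N v)"

definition sigma_z :: "complex mat" where
  "sigma_z = mat_of_rows_list 2 [[1, 0], [0, - 1]]"

definition sigma_z_on :: "nat \<Rightarrow> nat \<Rightarrow> complex mat" where
  "sigma_z_on N i = tensor_mats (map (\<lambda>k. if k = i then sigma_z else 1\<^sub>m 2) [1..<Suc N])"

text \<open>
  Matrices of all sizes share one type without a zero common to all of them, so the sum of
  matrices is taken entrywise.
\<close>

definition h3 :: "nat \<Rightarrow> complex mat" where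
  "h3 N = mat (2 ^ N) (2 ^ N) (\<lambda>rc.
     \<Sum>i\<in>{1..N}. \<Sum>j\<in>{i<..N}. \<Sum>l\<in>{j<..N}.
       (sigma_z_on N i * sigma_z_on N j * sigma_z_on N l) $$ rc)"

text \<open>
  \<open>\<langle>\<psi>|A|\<psi>\<rangle>\<close>, where \<open>\<bullet>c\<close> conjugates its second argument.
\<close>

definition expval :: "complex vec \<Rightarrow> complex mat \<Rightarrow> complex" where
  "expval \<psi> A = (A *\<^sub>v \<psi>) \<bullet>c \<psi>"

text \<open>
  The quantum Fisher information of the pure probe \<open>\<psi>\<close> for estimating \<open>J\<close> in the encoding
  Hamiltonian \<open>J \<cdot> H\<close>. It is kept complex-valued: \<open>q \<le> complex_of_real V\<close> means
  \<open>Re q \<le> V\<close> together with \<open>Im q = 0\<close>.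
\<close>

definition pure_qfi :: "complex mat \<Rightarrow> complex vec \<Rightarrow> complex" where
  "pure_qfi H \<psi> = 4 * (expval \<psi> (H * H) - (expval \<psi> H)\<^sup>2)"

definition unit_qubit :: "complex vec \<Rightarrow> bool" where
  "unit_qubit \<phi> \<longleftrightarrow> \<phi> \<in> carrier_vec 2 \<and> \<phi> \<bullet>c \<phi> = 1"

definition symmetric_product_states :: "nat \<Rightarrow> complex vec set" where
  "symmetric_product_states N = {tensor_power_vec \<phi> N | \<phi>. unit_qubit \<phi>}"

end

theory Submission
  imports Defs
begin

text \<open>
  Measured in the computational basis, \<open>\<phi>\<^sup>\<otimes>\<^sup>N\<close> makes the \<open>N\<close> spins independent signs of mean
  \<open>m = \<bar>\<phi>\<^sub>0\<bar>\<^sup>2 - \<bar>\<phi>\<^sub>1\<bar>\<^sup>2\<close>, and \<open>h3\<close> becomes their third elementary symmetric polynomial. Its variance is a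
  binomial coefficient times a cubic in \<open>y = m\<^sup>2\<close>, which has a single critical point on
  \<open>y \<ge> 0\<close>, its maximum; this point lies in \<open>[0, 1]\<close>, the range of \<open>m\<^sup>2\<close>.
\<close>

section \<open>Signs of qubits as bits of a basis index\<close>

text \<open>
  Qubit \<open>i\<close> is bit \<open>N - i\<close> of a basis index, so adding a qubit in front adds a top bit and leaves
  the signs of the lower bits unchanged.
\<close>
definition bit_sign :: "nat \<Rightarrow> nat \<Rightarrow> real" where
  "bit_sign t r = (if odd (r div 2 ^ t) then - 1 else 1)"

text \<open>The \<open>k\<close>-th elementary symmetric polynomial of the signs at bits
  \<open>0\<close> to \<open>n - 1\<close>, sorted by the highest chosen bit \<open>t\<close>. This
  makes splitting off a new top bit immediate.\<close>

fun sign_esym :: "nat \<Rightarrow> nat \<Rightarrow> nat \<Rightarrow> real" where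
  "sign_esym 0 n r = 1"
| "sign_esym (Suc k) n r = (\<Sum>t<n. bit_sign t r * sign_esym k t r)"

text \<open>For \<open>t < n\<close> the number \<open>2 ^ n\<close> is an even multiple of
  \<open>2 ^ t\<close>, so the parity of the quotient does not change.\<close>

lemma bit_sign_add_low [simp]: "t < n \<Longrightarrow> bit_sign t (2 ^ n + r) = bit_sign t r"
proof -
  assume "t < n"
  then have "(2::nat) ^ n = 2 ^ t * (2 * 2 ^ (n - Suc t))"
    by (simp flip: power_add power_Suc)
  then have "(2 ^ n + r) div 2 ^ t = 2 * 2 ^ (n - Suc t) + r div 2 ^ t"
    by simp
  then show ?thesis by (simp add: bit_sign_def)
qed

lemma bit_sign_mod: "t < n \<Longrightarrow> bit_sign t (r mod 2 ^ n) = bit_sign t r"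
proof -
  assume "t < n"
  then have "(2::nat) ^ n = 2 ^ t * (2 * 2 ^ (n - Suc t))"
    by (simp flip: power_add power_Suc)
  then have e: "r = 2 ^ t * (2 * 2 ^ (n - Suc t) * (r div 2 ^ n)) + r mod 2 ^ n"
    by (metis mult.assoc mult_div_mod_eq)
  have "r div 2 ^ t = 2 * 2 ^ (n - Suc t) * (r div 2 ^ n) + (r mod 2 ^ n) div 2 ^ t"
    using arg_cong[OF e, of "\<lambda>s. s div 2 ^ t"] by simp
  then show ?thesis by (simp add: bit_sign_def)
qed

lemma bit_sign_top:
  assumes "r < 2 ^ n"
  shows "bit_sign n r = 1" "bit_sign n (2 ^ n + r) = - 1"
  using assms by (auto simp: bit_sign_def)

lemma sign_esym_add_low [simp]: "t \<le> n \<Longrightarrow> sign_esym k t (2 ^ n + r) = sign_esym k t r"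
  by (induction k arbitrary: t) auto

text \<open>Later qubits sit at lower bits; this turns a range of qubits into a range of
  bits.\<close>

lemma sum_greaterThanAtMost_reflect:
  fixes f :: "nat \<Rightarrow> 'a::comm_monoid_add"
  shows "(\<Sum>j\<in>{i<..n}. f (n - j)) = (\<Sum>t<n - i. f t)"
  by (rule sum.reindex_bij_witness[of _ "\<lambda>t. n - t" "\<lambda>j. n - j"]) auto

section \<open>Diagonal form of the Hamiltonian\<close>

text \<open>Quotient and remainder by \<open>b\<close> together determine an index, so an
  off-diagonal entry has an off-diagonal factor.\<close>

lemma kron_mat_diag:
  "kron_mat (mat_diag a f) (mat_diag b g) = mat_diag (a * b) (\<lambda>i. f (i div b) * g (i mod b))"
proof (rule eq_matI)
  fix i j
  assume "i < dim_row (mat_diag (a * b) (\<lambda>i. f (i div b) * g (i mod b)))"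
    and "j < dim_col (mat_diag (a * b) (\<lambda>i. f (i div b) * g (i mod b)))"
  then have ij: "i < a * b" "j < a * b" by (auto simp: mat_diag_def)
  then have b: "b > 0" by (cases b) auto
  have "i div b < a" "j div b < a" using ij by (simp_all add: less_mult_imp_div_less)
  moreover have "i div b = j div b \<and> i mod b = j mod b \<longleftrightarrow> i = j"
    by (metis div_mult_mod_eq)
  ultimately show "kron_mat (mat_diag a f) (mat_diag b g) $$ (i, j) =
      mat_diag (a * b) (\<lambda>i. f (i div b) * g (i mod b)) $$ (i, j)"
    using ij b by (auto simp: kron_mat_def mat_diag_def)
qed (auto simp: kron_mat_def mat_diag_def)

lemma sigma_z_eq_mat_diag: "sigma_z = mat_diag 2 (\<lambda>i. complex_of_real (if odd i then - 1 else 1))"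
  by (rule eq_matI)
    (auto simp: sigma_z_def mat_diag_def mat_of_rows_list_def less_2_cases_iff)

text \<open>Generalized to the last \<open>n\<close> factors, because the tensor product folds from
  the right and induction on \<open>n\<close> then adds one factor in front.\<close>

lemma tensor_mats_sigma_z:
  "n \<le> N \<Longrightarrow> tensor_mats (map (\<lambda>k. if k = i then sigma_z else 1\<^sub>m 2) [Suc N - n..<Suc N]) =
    mat_diag (2 ^ n) (\<lambda>r. complex_of_real
      (if i \<in> {Suc N - n..N} then bit_sign (N - i) r else 1))"
proof (induction n)
  case 0
  then show ?case by (auto simp: tensor_mats_def mat_diag_def intro!: eq_matI)
next
  case (Suc n)
  define g where
    "g = (\<lambda>n r. complex_of_real (if i \<in> {Suc N - n..N} then bit_sign (N - i) r else 1))"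
  have "[Suc N - Suc n..<Suc N] = (N - n) # [Suc N - n..<Suc N]"
    using Suc.prems by (subst upt_rec) (auto simp: Suc_diff_le)
  then have "tensor_mats (map (\<lambda>k. if k = i then sigma_z else 1\<^sub>m 2) [Suc N - Suc n..<Suc N]) =
      kron_mat (if N - n = i then sigma_z else 1\<^sub>m 2)
        (tensor_mats (map (\<lambda>k. if k = i then sigma_z else 1\<^sub>m 2) [Suc N - n..<Suc N]))"
    by (simp add: tensor_mats_def del: upt_Suc)
  also have "tensor_mats (map (\<lambda>k. if k = i then sigma_z else 1\<^sub>m 2) [Suc N - n..<Suc N]) =
      mat_diag (2 ^ n) (g n)"
    using Suc by (simp add: g_def del: upt_Suc)
  also have "(if N - n = i then sigma_z else 1\<^sub>m 2) =
      mat_diag 2 (\<lambda>b. complex_of_real (if N - n = i \<and> odd b then - 1 else 1))"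
    by (auto simp: sigma_z_eq_mat_diag mat_diag_def intro!: eq_matI)
  also have "kron_mat \<dots> (mat_diag (2 ^ n) (g n)) = mat_diag (2 ^ Suc n) (g (Suc n))"
  proof -
    have "complex_of_real (if N - n = i \<and> odd (r div 2 ^ n) then - 1 else 1) * g n (r mod 2 ^ n) =
        g (Suc n) r" if "r < 2 ^ Suc n" for r
    proof -
      \<comment> \<open>Qubit \<open>i\<close> is the factor just added, one already present, one
        still to come, or no factor at all.\<close>
      consider "i = N - n" | "i \<in> {Suc N - n..N}" | "i < N - n" | "i > N"
        by force
      then show ?thesis
      proof cases
        case 1
        with Suc.prems have "N - i = n" by simp
        with 1 Suc.prems show ?thesis by (auto simp: g_def bit_sign_def)
      next
        case 2
        with Suc.prems have "N - i < n" by auto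
        with 2 Suc.prems show ?thesis by (auto simp: g_def bit_sign_mod)
      qed (use Suc.prems in \<open>auto simp: g_def\<close>)
    qed
    then show ?thesis
      unfolding kron_mat_diag by (auto simp: mat_diag_def intro!: eq_matI)
  qed
  finally show ?case by (simp add: g_def)
qed

lemma sigma_z_on_eq_mat_diag:
  "i \<in> {1..N} \<Longrightarrow> sigma_z_on N i = mat_diag (2 ^ N) (\<lambda>r. complex_of_real (bit_sign (N - i) r))"
  using tensor_mats_sigma_z[of N N i] by (simp add: sigma_z_on_def)

text \<open>Products of diagonal matrices are diagonal, and increasing triples of qubits become
  decreasing triples of bits, which is how \<open>sign_esym 3\<close> nests its sums.\<close>

lemma h3_eq_mat_diag: "h3 N = mat_diag (2 ^ N) (\<lambda>r. complex_of_real (sign_esym 3 N r))"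
proof (rule eq_matI)
  fix r c
  assume "r < dim_row (mat_diag (2 ^ N) (\<lambda>r. complex_of_real (sign_esym 3 N r)))"
    and "c < dim_col (mat_diag (2 ^ N) (\<lambda>r. complex_of_real (sign_esym 3 N r)))"
  then have rc: "r < 2 ^ N" "c < 2 ^ N" by (auto simp: mat_diag_def)
  \<comment> \<open>The outer range is written as \<open>{0<..N}\<close> so that all three sums have
    the shape that can be reflected.\<close>
  have "h3 N $$ (r, c) = (\<Sum>i\<in>{0<..N}. \<Sum>j\<in>{i<..N}. \<Sum>l\<in>{j<..N}.
      (sigma_z_on N i * sigma_z_on N j * sigma_z_on N l) $$ (r, c))"
    using rc by (simp add: h3_def flip: atLeastSucAtMost_greaterThanAtMost)
  also have "\<dots> = (\<Sum>i\<in>{0<..N}. \<Sum>j\<in>{i<..N}. \<Sum>l\<in>{j<..N}. if r = c then complex_of_real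
      (bit_sign (N - i) r * (bit_sign (N - j) r * bit_sign (N - l) r)) else 0)"
    using rc by (intro sum.cong refl) (simp add: sigma_z_on_eq_mat_diag, simp add: mat_diag_def mult.assoc)
  also have "\<dots> = (if r = c then complex_of_real (\<Sum>i\<in>{0<..N}. bit_sign (N - i) r *
      (\<Sum>j\<in>{i<..N}. bit_sign (N - j) r * (\<Sum>l\<in>{j<..N}. bit_sign (N - l) r))) else 0)"
    by (simp add: sum_distrib_left)
  also have "(\<Sum>i\<in>{0<..N}. bit_sign (N - i) r *
      (\<Sum>j\<in>{i<..N}. bit_sign (N - j) r * (\<Sum>l\<in>{j<..N}. bit_sign (N - l) r))) = sign_esym 3 N r"
    by (simp add: sum_greaterThanAtMost_reflect[where f = "\<lambda>t. bit_sign t r"]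
        sum_greaterThanAtMost_reflect[where f = "\<lambda>t. bit_sign t r * (\<Sum>u<t. bit_sign u r)"]
        sum_greaterThanAtMost_reflect[where i = 0 and f = "\<lambda>t. bit_sign t r *
          (\<Sum>u<t. bit_sign u r * (\<Sum>v<u. bit_sign v r))", simplified]
        numeral_3_eq_3)
  finally show "h3 N $$ (r, c) = mat_diag (2 ^ N) (\<lambda>r. complex_of_real (sign_esym 3 N r)) $$ (r, c)"
    using rc by (auto simp: mat_diag_def)
qed (auto simp: h3_def mat_diag_def)

section \<open>Expectation values as averages over measurement outcomes\<close>

lemma dim_tensor_power_vec [simp]: "v \<in> carrier_vec d \<Longrightarrow> dim_vec (tensor_power_vec v n) = d ^ n"
  by (induction n) (auto simp: tensor_power_vec_def tensor_vecs_def kron_vec_def)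

lemma tensor_power_vec_Suc: "tensor_power_vec v (Suc n) = kron_vec v (tensor_power_vec v n)"
  by (simp add: tensor_power_vec_def tensor_vecs_def)

text \<open>Phases cancel against their conjugates, so a diagonal observable sees only the squared
  moduli of the amplitudes.\<close>

lemma expval_mat_diag:
  assumes "\<psi> \<in> carrier_vec d"
  shows "expval \<psi> (mat_diag d (\<lambda>r. complex_of_real (f r))) =
    complex_of_real (\<Sum>r<d. (cmod (\<psi> $ r))\<^sup>2 * f r)"
proof -
  have "(mat_diag d (\<lambda>r. complex_of_real (f r)) *\<^sub>v \<psi>) $ r = f r * \<psi> $ r" if "r < d" for r
    using that assms
    by (simp add: mat_diag_def scalar_prod_def if_distrib[of "\<lambda>x. x * _"] cong: if_cong)
  then show ?thesis
    using assms
    by (auto simp: expval_def scalar_prod_def complex_norm_square mult_ac atLeast0LessThan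
        simp del: of_real_power intro!: sum.cong)
qed

definition prob_expectation :: "complex vec \<Rightarrow> nat \<Rightarrow> (nat \<Rightarrow> real) \<Rightarrow> real" where
  "prob_expectation \<phi> n f = (\<Sum>r<2 ^ n. (cmod (tensor_power_vec \<phi> n $ r))\<^sup>2 * f r)"

text \<open>Conditioning on the top bit: it belongs to the first tensor factor, whose outcome is
  independent of the others.\<close>

lemma prob_expectation_Suc:
  assumes "\<phi> \<in> carrier_vec 2"
  shows "prob_expectation \<phi> (Suc n) f =
    (cmod (\<phi> $ 0))\<^sup>2 * prob_expectation \<phi> n f +
    (cmod (\<phi> $ 1))\<^sup>2 * prob_expectation \<phi> n (\<lambda>r. f (2 ^ n + r))"
proof -
  have nth: "tensor_power_vec \<phi> (Suc n) $ r = \<phi> $ (r div 2 ^ n) * tensor_power_vec \<phi> n $ (r mod 2 ^ n)"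
    if "r < 2 * 2 ^ n" for r
    using that assms by (simp add: tensor_power_vec_Suc kron_vec_def)
  have split: "{..<(2::nat) ^ Suc n} = {..<2 ^ n} \<union> (\<lambda>r. 2 ^ n + r) ` {..<2 ^ n}"
    by (auto simp: image_iff Bex_def) presburger
  have "prob_expectation \<phi> (Suc n) f =
      (\<Sum>r<2 ^ n. (cmod (tensor_power_vec \<phi> (Suc n) $ r))\<^sup>2 * f r) +
      (\<Sum>r<2 ^ n. (cmod (tensor_power_vec \<phi> (Suc n) $ (2 ^ n + r)))\<^sup>2 * f (2 ^ n + r))"
    unfolding prob_expectation_def split
    by (subst sum.union_disjoint) (auto simp: sum.reindex)
  also have "\<dots> = (cmod (\<phi> $ 0))\<^sup>2 * prob_expectation \<phi> n f +
    (cmod (\<phi> $ 1))\<^sup>2 * prob_expectation \<phi> n (\<lambda>r. f (2 ^ n + r))"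
    by (simp add: nth prob_expectation_def sum_distrib_left norm_mult power_mult_distrib mult_ac)
  finally show ?thesis .
qed

lemma prob_expectation_add:
  "prob_expectation \<phi> n (\<lambda>r. f r + g r) = prob_expectation \<phi> n f + prob_expectation \<phi> n g"
  by (simp add: prob_expectation_def distrib_left sum.distrib)

lemma prob_expectation_diff:
  "prob_expectation \<phi> n (\<lambda>r. f r - g r) = prob_expectation \<phi> n f - prob_expectation \<phi> n g"
  by (simp add: prob_expectation_def right_diff_distrib sum_subtractf)

lemma prob_expectation_cong:
  "(\<And>r. r < 2 ^ n \<Longrightarrow> f r = g r) \<Longrightarrow> prob_expectation \<phi> n f = prob_expectation \<phi> n g"
  by (simp add: prob_expectation_def)

section \<open>Joint moments of elementary symmetric polynomials\<close>

text \<open>Mixed indices are kept because the recursion for the second moment of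
  \<open>sign_esym 3\<close> runs through them; \<open>j = 0\<close> gives plain means.\<close>

definition esym_moment :: "complex vec \<Rightarrow> nat \<Rightarrow> nat \<Rightarrow> nat \<Rightarrow> real" where
  "esym_moment \<phi> j k n = prob_expectation \<phi> n (\<lambda>r. sign_esym j n r * sign_esym k n r)"

lemma esym_moment_zero:
  "esym_moment \<phi> 0 0 0 = 1" "esym_moment \<phi> (Suc j) k 0 = 0" "esym_moment \<phi> j (Suc k) 0 = 0"
  by (simp_all add: esym_moment_def prob_expectation_def tensor_power_vec_def tensor_vecs_def)

text \<open>A new sign \<open>s\<close> adds \<open>s\<close> times the polynomial of degree one
  less to each factor. Expand the product and use that \<open>s\<close> is independent of the rest,
  has mean \<open>m\<close> and squares to 1.\<close>

lemma esym_moment_Suc: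
  assumes "\<phi> \<in> carrier_vec 2"
    and norm: "(cmod (\<phi> $ 0))\<^sup>2 + (cmod (\<phi> $ 1))\<^sup>2 = 1"
    and m: "m = (cmod (\<phi> $ 0))\<^sup>2 - (cmod (\<phi> $ 1))\<^sup>2"
  shows "esym_moment \<phi> 0 0 (Suc n) = esym_moment \<phi> 0 0 n" (is ?A)
    and "esym_moment \<phi> 0 (Suc k) (Suc n) = esym_moment \<phi> 0 (Suc k) n + m * esym_moment \<phi> 0 k n" (is ?B)
    and "esym_moment \<phi> (Suc j) (Suc k) (Suc n) = esym_moment \<phi> (Suc j) (Suc k) n
      + m * (esym_moment \<phi> j (Suc k) n + esym_moment \<phi> (Suc j) k n) + esym_moment \<phi> j k n" (is ?C)
proof -
  define p q where "p = (cmod (\<phi> $ 0))\<^sup>2" and "q = (cmod (\<phi> $ 1))\<^sup>2"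
  let ?E = "prob_expectation \<phi> n"
  let ?e = "\<lambda>k. sign_esym k n"
  have q: "q = 1 - p" and m: "m = 2 * p - 1" using norm m by (auto simp: p_def q_def)
  have E: "esym_moment \<phi> j k (Suc n) =
      p * ?E (\<lambda>r. sign_esym j (Suc n) r * sign_esym k (Suc n) r) +
      q * ?E (\<lambda>r. sign_esym j (Suc n) (2 ^ n + r) * sign_esym k (Suc n) (2 ^ n + r))" for j k
    unfolding esym_moment_def prob_expectation_Suc[OF assms(1)] p_def q_def ..
  have step: "sign_esym (Suc k) (Suc n) r = ?e (Suc k) r + ?e k r"
    "sign_esym (Suc k) (Suc n) (2 ^ n + r) = ?e (Suc k) r - ?e k r" if "r < 2 ^ n" for k r
  proof -
    show "sign_esym (Suc k) (Suc n) r = ?e (Suc k) r + ?e k r"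
      using that by (simp add: bit_sign_top)
    show "sign_esym (Suc k) (Suc n) (2 ^ n + r) = ?e (Suc k) r - ?e k r"
      using that by (simp add: bit_sign_top)
  qed
  show ?A unfolding E by (simp add: esym_moment_def q algebra_simps)
  have "?E (\<lambda>r. sign_esym 0 (Suc n) r * sign_esym (Suc k) (Suc n) r) =
      esym_moment \<phi> 0 (Suc k) n + esym_moment \<phi> 0 k n"
    unfolding esym_moment_def prob_expectation_add[symmetric]
    by (rule prob_expectation_cong) (simp only: step sign_esym.simps(1) mult_1_left)
  moreover have "?E (\<lambda>r. sign_esym 0 (Suc n) (2 ^ n + r) * sign_esym (Suc k) (Suc n) (2 ^ n + r)) =
      esym_moment \<phi> 0 (Suc k) n - esym_moment \<phi> 0 k n"
    unfolding esym_moment_def prob_expectation_diff[symmetric]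
    by (rule prob_expectation_cong) (simp only: step sign_esym.simps(1) mult_1_left)
  ultimately show ?B unfolding E by (simp only: q m) (simp only: algebra_simps)
  \<comment> \<open>The product splits into a part even and a part odd in the new sign. Averaging
    with weights \<open>p\<close> and \<open>q\<close> multiplies them by \<open>p + q = 1\<close>
    and \<open>p - q = m\<close>.\<close>
  have "?E (\<lambda>r. sign_esym (Suc j) (Suc n) r * sign_esym (Suc k) (Suc n) r) =
      esym_moment \<phi> (Suc j) (Suc k) n + esym_moment \<phi> j k n
        + (esym_moment \<phi> j (Suc k) n + esym_moment \<phi> (Suc j) k n)"
    unfolding esym_moment_def prob_expectation_add[symmetric]
    by (rule prob_expectation_cong) (simp only: step, simp only: algebra_simps)
  moreover have "?E (\<lambda>r. sign_esym (Suc j) (Suc n) (2 ^ n + r) * sign_esym (Suc k) (Suc n) (2 ^ n + r)) =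
      esym_moment \<phi> (Suc j) (Suc k) n + esym_moment \<phi> j k n
        - (esym_moment \<phi> j (Suc k) n + esym_moment \<phi> (Suc j) k n)"
    unfolding esym_moment_def prob_expectation_add[symmetric] prob_expectation_diff[symmetric]
    by (rule prob_expectation_cong) (simp only: step, simp only: algebra_simps)
  ultimately show ?C unfolding E by (simp only: q m) (simp only: algebra_simps)
qed

text \<open>
  \<open>E[e\<^sub>j e\<^sub>k]\<close> sums \<open>m ^ (j + k - 2i)\<close> over pairs of a \<open>j\<close>-set and a \<open>k\<close>-set overlapping in \<open>i\<close> elements.
  Counting these pairs by their union, of size \<open>j + k - i\<close>, makes the recursion Pascal's rule.
\<close>
lemma esym_moment_third:
  fixes n :: nat
  assumes "\<phi> \<in> carrier_vec 2"
    and "(cmod (\<phi> $ 0))\<^sup>2 + (cmod (\<phi> $ 1))\<^sup>2 = 1"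
    and "m = (cmod (\<phi> $ 0))\<^sup>2 - (cmod (\<phi> $ 1))\<^sup>2"
  shows "esym_moment \<phi> 0 3 n = real (n choose 3) * m ^ 3"
    and "esym_moment \<phi> 3 3 n = real (n choose 3) + 12 * real (n choose 4) * m ^ 2
      + 30 * real (n choose 5) * m ^ 4 + 20 * real (n choose 6) * m ^ 6"
proof -
  define M where "M j k n = esym_moment \<phi> j k n" for j k n
  note rec = esym_moment_Suc[OF assms, folded M_def]
  note zero = esym_moment_zero[of \<phi>, folded M_def]
  \<comment> \<open>By symmetry only moments with \<open>j \<le> k\<close> need to be
    solved.\<close>
  have comm: "M j k n = M k j n" for j k n
    by (simp add: M_def esym_moment_def mult.commute)
  have S0: "M 0 1 (Suc n) = M 0 1 n + m * M 0 0 n" "M 0 2 (Suc n) = M 0 2 n + m * M 0 1 n"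
    "M 0 3 (Suc n) = M 0 3 n + m * M 0 2 n" for n
    using rec(2)[of 0 n] rec(2)[of 1 n] rec(2)[of 2 n]
    by (simp_all add: numeral_2_eq_2 numeral_3_eq_3)
  have S1: "M 1 1 (Suc n) = M 1 1 n + m * (M 0 1 n + M 0 1 n) + M 0 0 n"
    "M 1 2 (Suc n) = M 1 2 n + m * (M 0 2 n + M 1 1 n) + M 0 1 n"
    "M 1 3 (Suc n) = M 1 3 n + m * (M 0 3 n + M 1 2 n) + M 0 2 n"
    "M 2 2 (Suc n) = M 2 2 n + m * (M 1 2 n + M 1 2 n) + M 1 1 n"
    "M 2 3 (Suc n) = M 2 3 n + m * (M 1 3 n + M 2 2 n) + M 1 2 n"
    "M 3 3 (Suc n) = M 3 3 n + m * (M 2 3 n + M 2 3 n) + M 2 2 n" for n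
    using rec(3)[of 0 0 n] rec(3)[of 0 1 n] rec(3)[of 0 2 n] rec(3)[of 1 1 n]
      rec(3)[of 1 2 n] rec(3)[of 2 2 n] comm[of 1 0] comm[of 2 1] comm[of 3 2]
    by (simp_all add: numeral_2_eq_2 numeral_3_eq_3)
  have Z: "M 0 1 0 = 0" "M 0 2 0 = 0" "M 0 3 0 = 0" "M 1 1 0 = 0" "M 1 2 0 = 0" "M 1 3 0 = 0"
    "M 2 2 0 = 0" "M 2 3 0 = 0" "M 3 3 0 = 0"
    using zero(2,3) by (simp_all add: numeral_2_eq_2 numeral_3_eq_3)
  have pascal: "real (Suc n choose 1) = 1 + real (n choose 1)"
    "real (Suc n choose 2) = real (n choose 1) + real (n choose 2)"
    "real (Suc n choose 3) = real (n choose 2) + real (n choose 3)"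
    "real (Suc n choose 4) = real (n choose 3) + real (n choose 4)"
    "real (Suc n choose 5) = real (n choose 4) + real (n choose 5)"
    "real (Suc n choose 6) = real (n choose 5) + real (n choose 6)" for n
    by (simp_all add: eval_nat_numeral)
  have choose_zero: "real (0 choose 1) = 0" "real (0 choose 2) = 0" "real (0 choose 3) = 0"
    "real (0 choose 4) = 0" "real (0 choose 5) = 0" "real (0 choose 6) = 0"
    by simp_all
  have pow: "m ^ 2 = m * m" "m ^ 3 = m * m * m" "m ^ 4 = m * m * m * m"
    "m ^ 5 = m * m * m * m * m" "m ^ 6 = m * m * m * m * m * m"
    by (simp_all add: eval_nat_numeral)
  \<comment> \<open>The moments are solved in an order where each recursion refers only to itself
    and to moments of smaller \<open>j + k\<close>, already in closed form.\<close>
  have M00: "M 0 0 n = 1" for n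
    by (induction n) (simp_all add: zero rec)
  have M01: "M 0 1 n = real (n choose 1) * m" for n
    by (induction n) (simp only: Z choose_zero mult_zero_left mult_zero_right add_0_left,
        simp only: S0 M00 pascal, simp only: algebra_simps pow, linarith?)
  have M02: "M 0 2 n = real (n choose 2) * m ^ 2" for n
    by (induction n) (simp only: Z choose_zero mult_zero_left mult_zero_right add_0_left,
        simp only: S0 M01 pascal, simp only: algebra_simps pow, linarith?)
  have M03: "M 0 3 n = real (n choose 3) * m ^ 3" for n
    by (induction n) (simp only: Z choose_zero mult_zero_left mult_zero_right add_0_left,
        simp only: S0 M02 pascal, simp only: algebra_simps pow, linarith?)
  have M11: "M 1 1 n = real (n choose 1) + 2 * real (n choose 2) * m ^ 2" for n
    by (induction n) (simp only: Z choose_zero mult_zero_left mult_zero_right add_0_left,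
        simp only: S1 M00 M01 pascal, simp only: algebra_simps pow, linarith?)
  have M12: "M 1 2 n = 2 * real (n choose 2) * m + 3 * real (n choose 3) * m ^ 3" for n
    by (induction n) (simp only: Z choose_zero mult_zero_left mult_zero_right add_0_left,
        simp only: S1 M01 M02 M11 pascal, simp only: algebra_simps pow, linarith?)
  have M13: "M 1 3 n = 3 * real (n choose 3) * m ^ 2 + 4 * real (n choose 4) * m ^ 4" for n
    by (induction n) (simp only: Z choose_zero mult_zero_left mult_zero_right add_0_left,
        simp only: S1 M02 M03 M12 pascal, simp only: algebra_simps pow, linarith?)
  have M22: "M 2 2 n = real (n choose 2) + 6 * real (n choose 3) * m ^ 2
      + 6 * real (n choose 4) * m ^ 4" for n
    by (induction n) (simp only: Z choose_zero mult_zero_left mult_zero_right add_0_left,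
        simp only: S1 M11 M12 pascal, simp only: algebra_simps pow, linarith?)
  have M23: "M 2 3 n = 3 * real (n choose 3) * m + 12 * real (n choose 4) * m ^ 3
      + 10 * real (n choose 5) * m ^ 5" for n
    by (induction n) (simp only: Z choose_zero mult_zero_left mult_zero_right add_0_left,
        simp only: S1 M12 M13 M22 pascal, simp only: algebra_simps pow, linarith?)
  \<comment> \<open>The coefficients 1, 12, 30, 20 are
    \<open>(6 - i)! / (i! (3 - i)! (3 - i)!)\<close> for overlaps \<open>i\<close> = 3, 2, 1, 0: the
    ways to write a fixed union as two such 3-sets.\<close>
  have M33: "M 3 3 n = real (n choose 3) + 12 * real (n choose 4) * m ^ 2
      + 30 * real (n choose 5) * m ^ 4 + 20 * real (n choose 6) * m ^ 6" for n
    by (induction n) (simp only: Z choose_zero mult_zero_left mult_zero_right add_0_left,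
        simp only: S1 M22 M23 pascal, simp only: algebra_simps pow, linarith?)
  show "esym_moment \<phi> 0 3 n = real (n choose 3) * m ^ 3"
    "esym_moment \<phi> 3 3 n = real (n choose 3) + 12 * real (n choose 4) * m ^ 2
      + 30 * real (n choose 5) * m ^ 4 + 20 * real (n choose 6) * m ^ 6"
    using M03[of n] M33[of n] by (simp_all only: M_def)
qed

section \<open>The Fisher information as a cubic\<close>

lemma real_choose_3456:
  fixes n :: nat
  defines "x \<equiv> real n"
  shows "real (n choose 3) = x * (x - 1) * (x - 2) / 6"
    and "real (n choose 4) = x * (x - 1) * (x - 2) * (x - 3) / 24"
    and "real (n choose 5) = x * (x - 1) * (x - 2) * (x - 3) * (x - 4) / 120"
    and "real (n choose 6) = x * (x - 1) * (x - 2) * (x - 3) * (x - 4) * (x - 5) / 720"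
  by (simp_all add: x_def binomial_gbinomial gbinomial_prod_rev eval_nat_numeral)

text \<open>The Fisher information divided by \<open>4 * (N choose 3)\<close>, with
  \<open>a = N - 3\<close> and \<open>y = m\<^sup>2\<close>. It is 1 at \<open>y = 0\<close> and
  vanishes at \<open>y = 1\<close>, where the probe is an eigenstate.\<close>

definition qfi_cubic :: "real \<Rightarrow> real \<Rightarrow> real" where
  "qfi_cubic a y = 1 + 3 * a * y + 3 / 2 * a * (a - 1) * y ^ 2 - (3 * a ^ 2 + 3 * a + 2) / 2 * y ^ 3"

text \<open>For \<open>a > 0\<close>, the larger root of \<open>(3 * a ^ 2 + 3 * a + 2) * y ^ 2 - 2
  * a * (a - 1) * y - 2 * a\<close>, which is the derivative of \<open>qfi_cubic a\<close> up to the
  factor \<open>- 3 / 2\<close>.\<close>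

definition qfi_argmax :: "real \<Rightarrow> real" where
  "qfi_argmax a = (a * (a - 1) + sqrt (a * (a + 1) * (a ^ 2 + 3 * a + 4))) / (3 * a ^ 2 + 3 * a + 2)"

lemma unit_qubit_norm:
  "unit_qubit \<phi> \<longleftrightarrow> \<phi> \<in> carrier_vec 2 \<and> (cmod (\<phi> $ 0))\<^sup>2 + (cmod (\<phi> $ 1))\<^sup>2 = 1"
proof -
  have "\<phi> \<bullet>c \<phi> = complex_of_real ((cmod (\<phi> $ 0))\<^sup>2 + (cmod (\<phi> $ 1))\<^sup>2)" if "\<phi> \<in> carrier_vec 2"
  proof -
    have "{0..<2} = {0, 1::nat}" by auto
    then show ?thesis
      using that by (simp add: scalar_prod_def complex_norm_square del: of_real_power)
  qed
  then show ?thesis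
    unfolding unit_qubit_def by (metis of_real_eq_1_iff)
qed

text \<open>The Fisher information is four times the variance of \<open>sign_esym 3\<close> under
  the measured distribution, so the two moments of the third polynomial determine it.\<close>

lemma pure_qfi_h3_tensor_power:
  fixes N :: nat
  assumes "unit_qubit \<phi>"
  defines "m \<equiv> (cmod (\<phi> $ 0))\<^sup>2 - (cmod (\<phi> $ 1))\<^sup>2" and "x \<equiv> real N"
  shows "pure_qfi (h3 N) (tensor_power_vec \<phi> N) =
    complex_of_real (2 / 3 * x * (x - 1) * (x - 2) * qfi_cubic (x - 3) (m\<^sup>2))"
proof -
  from assms(1) have \<phi>: "\<phi> \<in> carrier_vec 2" and norm: "(cmod (\<phi> $ 0))\<^sup>2 + (cmod (\<phi> $ 1))\<^sup>2 = 1"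
    by (simp_all add: unit_qubit_norm)
  have \<psi>: "tensor_power_vec \<phi> N \<in> carrier_vec (2 ^ N)"
    using dim_tensor_power_vec[OF \<phi>] by (rule carrier_vecI)
  have sq: "h3 N * h3 N = mat_diag (2 ^ N) (\<lambda>r. complex_of_real (sign_esym 3 N r * sign_esym 3 N r))"
    by (simp add: h3_eq_mat_diag)
  have e1: "expval (tensor_power_vec \<phi> N) (h3 N) = complex_of_real (esym_moment \<phi> 0 3 N)"
    unfolding h3_eq_mat_diag expval_mat_diag[OF \<psi>]
    by (simp add: esym_moment_def prob_expectation_def)
  have e2: "expval (tensor_power_vec \<phi> N) (h3 N * h3 N) = complex_of_real (esym_moment \<phi> 3 3 N)"
    unfolding sq expval_mat_diag[OF \<psi>] esym_moment_def prob_expectation_def ..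
  have "pure_qfi (h3 N) (tensor_power_vec \<phi> N) =
      complex_of_real (4 * (esym_moment \<phi> 3 3 N - (esym_moment \<phi> 0 3 N)\<^sup>2))"
    by (simp add: pure_qfi_def e1 e2)
  also have "4 * (esym_moment \<phi> 3 3 N - (esym_moment \<phi> 0 3 N)\<^sup>2) =
      2 / 3 * x * (x - 1) * (x - 2) * qfi_cubic (x - 3) (m\<^sup>2)"
    unfolding esym_moment_third[OF \<phi> norm m_def[THEN meta_eq_to_obj_eq]] qfi_cubic_def
      real_choose_3456 x_def[symmetric]
    by (simp add: field_simps eval_nat_numeral)
  finally show ?thesis .
qed

section \<open>Maximization of the cubic\<close>

lemma qfi_argmax_root:
  fixes a :: real
  assumes "a > 0"
  defines "D \<equiv> sqrt (a * (a + 1) * (a ^ 2 + 3 * a + 4))"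
  shows "D ^ 2 = a * (a + 1) * (a ^ 2 + 3 * a + 4)" "D \<ge> a * (a - 1)" "D \<ge> 0"
    "(3 * a ^ 2 + 3 * a + 2) * qfi_argmax a = a * (a - 1) + D"
proof -
  show D: "D ^ 2 = a * (a + 1) * (a ^ 2 + 3 * a + 4)" "D \<ge> 0"
    using assms by (simp_all add: D_def)
  \<comment> \<open>\<open>D ^ 2\<close> is a quarter of the discriminant of the quadratic for the
    critical point.\<close>
  have "(a * (a - 1)) ^ 2 + 2 * a * (3 * a ^ 2 + 3 * a + 2) = D ^ 2"
    unfolding D(1) by (simp add: field_simps eval_nat_numeral)
  moreover have "2 * a * (3 * a ^ 2 + 3 * a + 2) \<ge> 0" using assms by simp
  ultimately have "(a * (a - 1)) ^ 2 \<le> D ^ 2" by linarith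
  then show "D \<ge> a * (a - 1)" by (rule power2_le_imp_le) (rule D)
  have "3 * a ^ 2 + 3 * a + 2 > 0" using assms by (simp add: add_pos_pos)
  then show "(3 * a ^ 2 + 3 * a + 2) * qfi_argmax a = a * (a - 1) + D"
    by (simp add: qfi_argmax_def D_def)
qed

text \<open>These bounds make the critical point a possible value of \<open>m\<^sup>2\<close>, so
  that the maximum is attained.\<close>

lemma qfi_argmax_bounds:
  assumes "a > 0"
  shows "0 \<le> qfi_argmax a" "qfi_argmax a \<le> 1"
proof -
  define D where "D = sqrt (a * (a + 1) * (a ^ 2 + 3 * a + 4))"
  note D = qfi_argmax_root[OF assms, folded D_def]
  have c: "3 * a ^ 2 + 3 * a + 2 > 0" using assms by (simp add: add_pos_pos)
  \<comment> \<open>The number being squared is \<open>3 * a ^ 2 + 3 * a + 2 - a * (a - 1)\<close>,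
    the bound on \<open>D\<close> that means \<open>qfi_argmax a \<le> 1\<close>.\<close>
  have "D ^ 2 \<le> (2 * a ^ 2 + 4 * a + 2) ^ 2"
    using assms unfolding D(1) by (simp add: field_simps eval_nat_numeral)
  then have "D \<le> 2 * a ^ 2 + 4 * a + 2"
    using assms by (elim power2_le_imp_le) simp
  then have "a * (a - 1) + D \<le> 3 * a ^ 2 + 3 * a + 2"
    by (simp add: algebra_simps power2_eq_square)
  then show "qfi_argmax a \<le> 1"
    using c by (simp add: qfi_argmax_def D_def)
  have "a * (a - 1) + D \<ge> 0"
  proof -
    \<comment> \<open>For \<open>a < 1\<close> the summand \<open>a * (a - 1)\<close> is negative,
      so \<open>D\<close> has to outweigh it.\<close>
    have "(a * (1 - a)) ^ 2 \<le> D ^ 2"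
      using assms unfolding D(1) by (simp add: field_simps eval_nat_numeral)
    then have "a * (1 - a) \<le> D" by (rule power2_le_imp_le) (rule D)
    then show ?thesis by (simp add: algebra_simps)
  qed
  then show "0 \<le> qfi_argmax a" using c by (simp add: qfi_argmax_def D_def)
qed

lemma qfi_cubic_le_argmax:
  assumes "a > 0" "y \<ge> 0"
  shows "qfi_cubic a y \<le> qfi_cubic a (qfi_argmax a)"
proof -
  define D where "D = sqrt (a * (a + 1) * (a ^ 2 + 3 * a + 4))"
  note D = qfi_argmax_root[OF assms(1), folded D_def]
  define c z where "c = 3 * a ^ 2 + 3 * a + 2" and "z = qfi_argmax a"
  have c: "c > 0" using assms by (simp add: c_def add_pos_pos)
  have cz: "c * z = a * (a - 1) + D" using D(4) by (simp add: c_def z_def)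
  \<comment> \<open>The derivative vanishes at \<open>z\<close>. Multiplied by \<open>c\<close>, the
    claim involves \<open>z\<close> only through \<open>c * z\<close>, which is known in terms of
    \<open>D\<close>.\<close>
  have crit: "c * z ^ 2 = 2 * a + 2 * a * (a - 1) * z"
  proof -
    have "c * (c * z ^ 2) = (a * (a - 1) + D) ^ 2"
      by (simp flip: cz add: power2_eq_square)
    also have "\<dots> = c * (2 * a) + 2 * a * (a - 1) * (c * z)"
      unfolding power2_sum D(1) cz unfolding c_def by (simp add: field_simps eval_nat_numeral)
    finally have "c * (c * z ^ 2) = c * (2 * a + 2 * a * (a - 1) * z)" by (simp add: algebra_simps)
    then show ?thesis using c by simp
  qed
  \<comment> \<open>The difference has a double root at the critical point \<open>z\<close>, leaving a linear factor.\<close>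
  have "qfi_cubic a z - qfi_cubic a y
      = (y - z) ^ 2 * (c * y + 2 * (c * z) - 3 * a * (a - 1)) / 2
        + (y - z) * 3 / 2 * (c * z ^ 2 - 2 * a - 2 * a * (a - 1) * z)"
    unfolding qfi_cubic_def c_def by (simp add: field_simps eval_nat_numeral)
  \<comment> \<open>\<open>crit\<close> removes the second summand, and \<open>cz\<close> expresses
    the linear factor through \<open>D\<close>.\<close>
  also have "\<dots> = (y - z) ^ 2 * (c * y + 2 * D - a * (a - 1)) / 2"
    unfolding crit cz by (simp add: algebra_simps)
  also have "\<dots> \<ge> 0"
  proof -
    have "c * y \<ge> 0" using c assms by simp
    \<comment> \<open>Add \<open>D \<ge> a * (a - 1)\<close> and \<open>D \<ge> 0\<close>.\<close>
    then have "c * y + 2 * D - a * (a - 1) \<ge> 0" using D(2,3) by linarith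
    then show ?thesis by simp
  qed
  finally show ?thesis by (simp add: z_def)
qed

text \<open>The leading coefficient is \<open>- c / 2\<close>, so the factor \<open>c ^ 2\<close>
  suffices to turn the value at \<open>z\<close> into a polynomial in \<open>c * z\<close>, hence in
  \<open>D\<close>; reducing powers of \<open>D\<close> leaves it linear in
  \<open>D\<close>.\<close>

lemma qfi_cubic_argmax:
  assumes "a > 0"
  defines "D \<equiv> sqrt (a * (a + 1) * (a ^ 2 + 3 * a + 4))"
  shows "qfi_cubic a (qfi_argmax a) * (3 * a ^ 2 + 3 * a + 2) ^ 2 =
    (a + 1) * (a * (a ^ 2 + 3 * a + 4) * D + ((a + 3) * a ^ 2 + 4) * (a + 1) ^ 2)"
proof -
  note D = qfi_argmax_root[OF assms(1), folded D_def]
  define c z where "c = 3 * a ^ 2 + 3 * a + 2" and "z = qfi_argmax a"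
  have cz: "c * z = a * (a - 1) + D" using D(4) by (simp add: c_def z_def)
  have D3: "D ^ 3 = a * (a + 1) * (a ^ 2 + 3 * a + 4) * D"
    using D(1) by (simp add: power3_eq_cube power2_eq_square)
  have "qfi_cubic a z * c ^ 2 = c ^ 2 + 3 * a * c * (c * z) + 3 / 2 * a * (a - 1) * (c * z) ^ 2
      - (c * z) ^ 3 / 2"
    unfolding qfi_cubic_def c_def[symmetric] by (simp add: field_simps eval_nat_numeral)
  also have "\<dots> = c ^ 2 + 3 * a * c * (a * (a - 1) + D)
      + 3 / 2 * a * (a - 1) * ((a * (a - 1)) ^ 2 + 2 * (a * (a - 1)) * D + D ^ 2)
      - ((a * (a - 1)) ^ 3 + 3 * (a * (a - 1)) ^ 2 * D + 3 * (a * (a - 1)) * D ^ 2 + D ^ 3) / 2"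
    unfolding cz by (simp add: field_simps eval_nat_numeral)
  also have "\<dots> = (a + 1) * (a * (a ^ 2 + 3 * a + 4) * D + ((a + 3) * a ^ 2 + 4) * (a + 1) ^ 2)"
    unfolding D(1) D3 c_def by (simp add: field_simps eval_nat_numeral)
  finally show ?thesis by (simp add: c_def z_def)
qed

section \<open>The closed form and its attainment\<close>

lemma max_value_eq:
  fixes n :: real
  assumes "n > 3"
  defines "x \<equiv> sqrt ((n - 3) * (n - 2) ^ 3 * (n - 1)\<^sup>2 * ((n - 3) * n + 4))"
  shows "2 * (n - 2) * n *
      ((n - 3) * ((n - 3) * n + 4) * x + (n - 1) * (n * (n - 3)\<^sup>2 + 4) * (n - 2) ^ 3)
      / (3 * (3 * (n - 5) * n + 20)\<^sup>2)
    = 2 / 3 * n * (n - 1) * (n - 2) * qfi_cubic (n - 3) (qfi_argmax (n - 3))"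
proof -
  define a where "a = n - 3"
  have n: "n = a + 3" and a: "a > 0" using assms by (simp_all add: a_def)
  define D where "D = sqrt (a * (a + 1) * (a ^ 2 + 3 * a + 4))"
  \<comment> \<open>A perfect square splits off the radicand, so \<open>x\<close> is a polynomial
    multiple of \<open>D\<close>.\<close>
  have "(n - 3) * (n - 2) ^ 3 * (n - 1)\<^sup>2 * ((n - 3) * n + 4) =
      ((a + 1) * (a + 2)) ^ 2 * (a * (a + 1) * (a ^ 2 + 3 * a + 4))"
    unfolding n by (simp add: field_simps eval_nat_numeral)
  then have x: "x = (a + 1) * (a + 2) * D"
    using a by (simp add: x_def D_def real_sqrt_mult)
  have c: "3 * (n - 5) * n + 20 = 3 * a ^ 2 + 3 * a + 2"
    unfolding n by (simp add: field_simps eval_nat_numeral)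
  have c0: "3 * a ^ 2 + 3 * a + 2 > 0" using a by (simp add: add_pos_pos)
  have "2 * (n - 2) * n *
      ((n - 3) * ((n - 3) * n + 4) * x + (n - 1) * (n * (n - 3)\<^sup>2 + 4) * (n - 2) ^ 3)
      = 2 * n * (n - 1) * (n - 2) * ((a + 1) *
        (a * (a ^ 2 + 3 * a + 4) * D + ((a + 3) * a ^ 2 + 4) * (a + 1) ^ 2))"
    unfolding x n by (simp add: field_simps eval_nat_numeral)
  also have "\<dots> = 2 * n * (n - 1) * (n - 2) *
      (qfi_cubic a (qfi_argmax a) * (3 * a ^ 2 + 3 * a + 2) ^ 2)"
    using qfi_cubic_argmax[OF a] by (simp add: D_def)
  finally have numerator: "2 * (n - 2) * n *
      ((n - 3) * ((n - 3) * n + 4) * x + (n - 1) * (n * (n - 3)\<^sup>2 + 4) * (n - 2) ^ 3)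
      = 2 * n * (n - 1) * (n - 2) * qfi_cubic a (qfi_argmax a) * (3 * a ^ 2 + 3 * a + 2) ^ 2"
    by (simp only: mult.assoc)
  show ?thesis
    unfolding c numerator unfolding a_def[symmetric] using c0 by simp
qed

text \<open>Real amplitudes with squares \<open>(1 + m) / 2\<close> and \<open>(1 - m) / 2\<close>
  realize any polarization.\<close>

lemma ex_unit_qubit_polarization:
  fixes m :: real
  assumes "\<bar>m\<bar> \<le> 1"
  shows "\<exists>\<phi>. unit_qubit \<phi> \<and> (cmod (\<phi> $ 0))\<^sup>2 - (cmod (\<phi> $ 1))\<^sup>2 = m"
proof -
  define \<phi> where "\<phi> = vec 2 (\<lambda>i. complex_of_real (sqrt ((1 + (if i = 0 then m else - m)) / 2)))"
  have "(cmod (\<phi> $ 0))\<^sup>2 = (1 + m) / 2" "(cmod (\<phi> $ 1))\<^sup>2 = (1 - m) / 2"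
    using assms by (simp_all add: \<phi>_def)
  then show ?thesis
    by (intro exI[of _ \<phi>]) (simp add: unit_qubit_norm \<phi>_def field_simps)
qed

theorem mainTheorem8:
  fixes N :: nat
  assumes "N > 3"
  shows "let n = real N;
             x = sqrt ((n - 3) * (n - 2) ^ 3 * (n - 1)\<^sup>2 * ((n - 3) * n + 4));
             V = 2 * (n - 2) * n *
                   ((n - 3) * ((n - 3) * n + 4) * x
                    + (n - 1) * (n * (n - 3)\<^sup>2 + 4) * (n - 2) ^ 3)
                 / (3 * (3 * (n - 5) * n + 20)\<^sup>2)
         in (\<exists>\<psi>\<in>symmetric_product_states N. pure_qfi (h3 N) \<psi> = complex_of_real V)
            \<and> (\<forall>\<psi>\<in>symmetric_product_states N. pure_qfi (h3 N) \<psi> \<le> complex_of_real V)"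
proof -
  define n where "n = real N"
  define z where "z = qfi_argmax (n - 3)"
  define V where "V = 2 / 3 * n * (n - 1) * (n - 2) * qfi_cubic (n - 3) z"
  have n: "n > 3" using assms by (simp add: n_def)
  have z: "0 \<le> z" "z \<le> 1" using qfi_argmax_bounds[of "n - 3"] n by (simp_all add: z_def)
  \<comment> \<open>Polarization \<open>sqrt z\<close> gives \<open>m\<^sup>2 = z\<close>, the
    maximizer of the cubic.\<close>
  then obtain \<phi> where \<phi>: "unit_qubit \<phi>" "(cmod (\<phi> $ 0))\<^sup>2 - (cmod (\<phi> $ 1))\<^sup>2 = sqrt z"
    using ex_unit_qubit_polarization[of "sqrt z"] by auto
  have "pure_qfi (h3 N) (tensor_power_vec \<phi> N) = complex_of_real V"
    unfolding pure_qfi_h3_tensor_power[OF \<phi>(1)] \<phi>(2) V_def n_def using z by simp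
  then have attained: "\<exists>\<psi>\<in>symmetric_product_states N. pure_qfi (h3 N) \<psi> = complex_of_real V"
    using \<phi>(1) by (auto simp: symmetric_product_states_def)
  have "pure_qfi (h3 N) \<psi> \<le> complex_of_real V" if "\<psi> \<in> symmetric_product_states N" for \<psi>
  proof -
    from that obtain \<chi> where \<chi>: "unit_qubit \<chi>" "\<psi> = tensor_power_vec \<chi> N"
      by (auto simp: symmetric_product_states_def)
    let ?m = "(cmod (\<chi> $ 0))\<^sup>2 - (cmod (\<chi> $ 1))\<^sup>2"
    \<comment> \<open>The prefactor is nonnegative as \<open>n > 3\<close>, and
      \<open>?m\<^sup>2\<close> is a nonnegative argument of the cubic.\<close>
    have "2 / 3 * n * (n - 1) * (n - 2) * qfi_cubic (n - 3) (?m\<^sup>2) \<le> V"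
      unfolding V_def z_def using n by (intro mult_left_mono qfi_cubic_le_argmax) auto
    then show ?thesis
      unfolding \<chi>(2) pure_qfi_h3_tensor_power[OF \<chi>(1)] n_def[symmetric]
      by (simp add: less_eq_complex_def)
  qed
  with attained show ?thesis
    unfolding Let_def n_def[symmetric] max_value_eq[OF n] z_def[symmetric] V_def[symmetric]
    by blast
qed

end
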